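(* Let $G_1$ and $G_2$ be graphs with $\mu(G_1) = k_1$ and $\mu(G_2) = k_2$, and let $H = G_1 \circ G_2$. Then $\mu(H) \le k_1 + k_2$. Moreover, if $k_1 \ge k_2$ and $G_2$ is the union of $k_1$ comparability graphs, then $\mu(H) = k_1$.
   Context: All graphs are simple, undirected and finite. A graph is word-representable if there is a word $w$ over its vertex set such that two distinct vertices are adjacent iff their occurrences alternate in $w$. A comparability graph is a graph admitting a transitive orientation. The union of graphs $G_1,\dots,G_k$ is the graph with vertex set $\bigcup V(G_i)$ and edge set $\bigcup E(G_i)$. The multi-word-representation number $\mu(G)$ is the smallest positive integer $k$ such that $G$ is the union of $k$ word-representable graphs. The lexicographic product $G_1 \circ G_2$ has vertex set $V(G_1)\times V(G_2)$, with $(u,v)$ and $(x,y)$ adjacent iff $\{u,x\}\in E(G_1)$, or $u=x$ and $\{v,y\}\in E(G_2)$. *)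

theory Defs
  imports "Graph_Theory.Graph_Theory"
begin

text \<open>
  A finite simple undirected graph is a \<open>pair_graph\<close>: a finite vertex set with a symmetric,
  irreflexive set of arcs. The edge \<open>{u, v}\<close> is present iff \<open>(u, v) \<in> parcs G\<close>, equivalently
  \<open>(v, u) \<in> parcs G\<close>. The empty graph is a \<open>pair_graph\<close>.
\<close>

text \<open>
  Two distinct letters alternate in a word if deleting all other letters leaves a word of the form
  \<open>xyxy\<dots>\<close> or \<open>yxyx\<dots>\<close>, of even or odd length. On a word over two letters this says that no two
  consecutive letters coincide.
\<close>

definition alternate :: "'a \<Rightarrow> 'a \<Rightarrow> 'a list \<Rightarrow> bool" where
  "alternate x y w \<longleftrightarrow> distinct_adj (filter (\<lambda>z. z = x \<or> z = y) w)"

definition represents :: "'a list \<Rightarrow> 'a pair_pre_digraph \<Rightarrow> bool" where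
  "represents w G \<longleftrightarrow>
     (\<forall>x \<in> pverts G. \<forall>y \<in> pverts G. x \<noteq> y \<longrightarrow> ((x, y) \<in> parcs G \<longleftrightarrow> alternate x y w))"

text \<open>
  As is customary, every vertex has to occur in the representing word. Lemma
  \<open>word_representable_iff_subset\<close> shows that dropping this requirement defines the same graphs.
\<close>

definition word_representable :: "'a pair_pre_digraph \<Rightarrow> bool" where
  "word_representable G \<longleftrightarrow> pair_graph G \<and> (\<exists>w. set w = pverts G \<and> represents w G)"

definition transitive_orientation :: "'a pair_pre_digraph \<Rightarrow> 'a rel \<Rightarrow> bool" where
  "transitive_orientation G T \<longleftrightarrow> parcs G = T \<union> T\<inverse> \<and> asym T \<and> trans T"

definition comparability_graph :: "'a pair_pre_digraph \<Rightarrow> bool" where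
  "comparability_graph G \<longleftrightarrow> pair_graph G \<and> (\<exists>T. transitive_orientation G T)"

definition graph_union :: "nat \<Rightarrow> (nat \<Rightarrow> 'a pair_pre_digraph) \<Rightarrow> 'a pair_pre_digraph" where
  "graph_union k F = \<lparr>pverts = (\<Union>i<k. pverts (F i)), parcs = (\<Union>i<k. parcs (F i))\<rparr>"

definition union_of :: "('a pair_pre_digraph \<Rightarrow> bool) \<Rightarrow> nat \<Rightarrow> 'a pair_pre_digraph \<Rightarrow> bool" where
  "union_of P k G \<longleftrightarrow> (\<exists>F. (\<forall>i<k. P (F i)) \<and> G = graph_union k F)"

definition multi_word_number :: "'a pair_pre_digraph \<Rightarrow> nat" ("\<mu>") where
  "\<mu> G = (LEAST k. 0 < k \<and> union_of word_representable k G)"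

definition lex_product ::
    "'a pair_pre_digraph \<Rightarrow> 'b pair_pre_digraph \<Rightarrow> ('a \<times> 'b) pair_pre_digraph"
    (infixl "\<circ>\<^sub>L" 70) where
  "G1 \<circ>\<^sub>L G2 =
     \<lparr>pverts = pverts G1 \<times> pverts G2,
      parcs = {((u, v), (x, y)) | u v x y.
        u \<in> pverts G1 \<and> v \<in> pverts G2 \<and> x \<in> pverts G1 \<and> y \<in> pverts G2 \<and>
        ((u, x) \<in> parcs G1 \<or> u = x \<and> (v, y) \<in> parcs G2)}\<rparr>"

lemma alternate_commute: "alternate x y w \<longleftrightarrow> alternate y x w"
  by (simp add: alternate_def disj_commute)

lemma alternate_append_absent:
  assumes "distinct vs" "set vs \<inter> set w = {}" "x \<noteq> y"
  shows "alternate x y (vs @ w) \<longleftrightarrow> alternate x y w"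
proof -
  have *: "alternate x y (a # w) \<longleftrightarrow> alternate x y w" if "a \<notin> set w" for a and w :: "'a list"
  proof -
    have "distinct_adj (a # filter (\<lambda>z. z = x \<or> z = y) w) \<longleftrightarrow>
          distinct_adj (filter (\<lambda>z. z = x \<or> z = y) w)"
      using that hd_in_set[of "filter (\<lambda>z. z = x \<or> z = y) w"]
      by (auto simp: distinct_adj_Cons)
    then show ?thesis by (simp add: alternate_def)
  qed
  show ?thesis using assms(1,2) by (induction vs) (auto simp: *)
qed

lemma word_representable_iff_subset:
  "word_representable G \<longleftrightarrow> pair_graph G \<and> (\<exists>w. set w \<subseteq> pverts G \<and> represents w G)"
proof
  assume "word_representable G"
  then show "pair_graph G \<and> (\<exists>w. set w \<subseteq> pverts G \<and> represents w G)"
    by (auto simp: word_representable_def)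
next
  assume R: "pair_graph G \<and> (\<exists>w. set w \<subseteq> pverts G \<and> represents w G)"
  then obtain w where w: "set w \<subseteq> pverts G" "represents w G" by blast
  have "finite (pverts G - set w)"
    using R pair_fin_digraph.pair_finite_verts pair_graph_def pair_digraph_def by blast
  then obtain vs where vs: "set vs = pverts G - set w" "distinct vs"
    using finite_distinct_list by blast
  have "alternate x y (vs @ w) \<longleftrightarrow> alternate x y w" if "x \<noteq> y" for x y
    using alternate_append_absent[OF vs(2) _ that] vs(1) by blast
  then have "represents (vs @ w) G"
    using w(2) by (simp add: represents_def)
  moreover have "set (vs @ w) = pverts G" using vs(1) w(1) by auto
  ultimately show "word_representable G"
    using R unfolding word_representable_def by blast
qed

end

theory Submission
  imports Defs
begin

text \<open>
  Let \<open>w\<close> represent \<open>F\<close>, and let \<open>C\<close> be the comparability graph of a partial order. Appending to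
  \<open>w\<close> the permutation that lists its letters by their last occurrence does not change the
  represented graph, so every letter may be assumed to occur as often as there are linear extensions
  of the order. Replace the occurrences of a letter \<open>u\<close> by the words \<open>{u} \<times> L\<close>, so that every linear
  extension \<open>L\<close> is used. Letters with different first components then alternate as in \<open>w\<close>, while
  \<open>(u, v)\<close> and \<open>(u, y)\<close> alternate iff \<open>v\<close> and \<open>y\<close> come in the same order in all linear extensions,
  i.e. iff they are comparable. Hence \<open>F \<circ>\<^sub>L C\<close> is word-representable. With \<open>C\<close> edgeless this handles
  the edges of \<open>H\<close> that come from \<open>G1\<close>; those from \<open>G2\<close> form disjoint copies of \<open>G2\<close>. For the equality,
  pad the parts of \<open>G1\<close> and \<open>G2\<close> with isolated vertices and take their products one by one; conversely,
  \<open>G1\<close> is an induced subgraph of \<open>H\<close>.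
\<close>

section \<open>Graphs\<close>

lemma pair_graph_iff:
  "pair_graph G \<longleftrightarrow>
     finite (pverts G) \<and> parcs G \<subseteq> pverts G \<times> pverts G \<and> sym (parcs G) \<and> irrefl (parcs G)"
proof
  assume "pair_graph G"
  then interpret pair_graph G .
  show "finite (pverts G) \<and> parcs G \<subseteq> pverts G \<times> pverts G \<and> sym (parcs G) \<and> irrefl (parcs G)"
    using pair_finite_verts pair_sym_arcs pair_no_loops
    by (fastforce simp: irrefl_def symmetric_def dest: in_arcsD1 in_arcsD2)
next
  assume *: "finite (pverts G) \<and> parcs G \<subseteq> pverts G \<times> pverts G \<and> sym (parcs G) \<and> irrefl (parcs G)"
  then have "finite (parcs G)" by (meson finite_SigmaI finite_subset)
  with * show "pair_graph G"
    by unfold_locales (auto simp: irrefl_def symmetric_def)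
qed

abbreviation edgeless :: "'a set \<Rightarrow> 'a pair_pre_digraph" where
  "edgeless A \<equiv> \<lparr>pverts = A, parcs = {}\<rparr>"

lemma comparability_graph_edgeless: "finite A \<Longrightarrow> comparability_graph (edgeless A)"
  unfolding comparability_graph_def transitive_orientation_def pair_graph_iff
  by (auto simp: sym_def irrefl_def asym_on_def intro!: exI[of _ "{}"])

lemma comparability_graph_add_vertices:
  assumes "comparability_graph G" "pverts G \<subseteq> A" "finite A"
  shows "comparability_graph \<lparr>pverts = A, parcs = parcs G\<rparr>"
  using assms unfolding comparability_graph_def transitive_orientation_def pair_graph_iff
  by auto

lemma pair_graph_lex_product:
  assumes "pair_graph F" "pair_graph G"
  shows "pair_graph (F \<circ>\<^sub>L G)"
  using assms unfolding pair_graph_iff lex_product_def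
  by (auto simp: sym_def irrefl_def)

lemma in_parcs_lex_product:
  assumes "u \<in> pverts F" "x \<in> pverts F" "v \<in> pverts G" "y \<in> pverts G"
  shows "((u, v), (x, y)) \<in> parcs (F \<circ>\<^sub>L G) \<longleftrightarrow> (u, x) \<in> parcs F \<or> u = x \<and> (v, y) \<in> parcs G"
  using assms by (simp add: lex_product_def)

section \<open>Alternation\<close>

lemma last_remdups: "last (remdups xs) = last xs"
  by (induction xs) auto

text \<open>\<open>remdups\<close> keeps last occurrences, so on two letters it yields a two-letter
  word that ends in the last letter of \<open>v\<close>. It begins with the other letter, so the
  junction creates no repetition.\<close>

lemma distinct_adj_append_remdups:
  assumes "set v = {x, y}" "x \<noteq> y"
  shows "distinct_adj (v @ remdups v) \<longleftrightarrow> distinct_adj v"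
proof -
  have "length (remdups v) = 2" using assms by (simp add: length_remdups_card_conv)
  then obtain a b where ab: "remdups v = [a, b]"
    by (metis (no_types, lifting) One_nat_def Suc_1 length_0_conv length_Suc_conv)
  then have "a \<noteq> b" using distinct_remdups[of v] by simp
  moreover have "last v = b" using last_remdups[of v] ab by simp
  ultimately show ?thesis by (auto simp: ab distinct_adj_append_iff)
qed

lemma alternate_append_remdups:
  assumes "x \<in> set w" "y \<in> set w" "x \<noteq> y"
  shows "alternate x y (w @ remdups w) \<longleftrightarrow> alternate x y w"
proof -
  have "set (filter (\<lambda>z. z = x \<or> z = y) w) = {x, y}" using assms by auto
  from distinct_adj_append_remdups[OF this assms(3)] show ?thesis
    by (simp add: alternate_def remdups_filter)
qed

lemma represents_append_remdups:
  assumes "set w = pverts G" "represents w G"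
  shows "represents (w @ remdups w) G"
  using assms alternate_append_remdups[of _ w] by (simp add: represents_def)

text \<open>Deleting the other letters puts the \<open>v\<close> from \<open>remdups w\<close> right
  after those from \<open>w\<close>. This later keeps letters of different copies from
  alternating.\<close>

lemma not_distinct_adj_repeated:
  assumes "v \<in> set w"
  shows "\<not> distinct_adj (filter (\<lambda>z. z = v) (w @ remdups w))"
proof -
  have ne: "filter (\<lambda>z. z = v) w \<noteq> []" "filter (\<lambda>z. z = v) (remdups w) \<noteq> []"
    using assms by (auto simp: filter_empty_conv)
  have "last (filter (\<lambda>z. z = v) w) = v" using last_in_set[OF ne(1)] by simp
  moreover have "hd (filter (\<lambda>z. z = v) (remdups w)) = v" using hd_in_set[OF ne(2)] by simp
  ultimately show ?thesis using ne by (simp add: distinct_adj_append_iff)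
qed

text \<open>A letter repeats at the junction of two successive blocks exactly if the blocks differ,
  so all blocks must be equal. Inclusions instead of equalities also cover the empty list.\<close>

lemma distinct_adj_concat_pairs:
  assumes "\<And>p. p \<in> set ps \<Longrightarrow> p = [v, y] \<or> p = [y, v]" "v \<noteq> y"
  shows "distinct_adj (concat ps) \<longleftrightarrow> set ps \<subseteq> {[v, y]} \<or> set ps \<subseteq> {[y, v]}"
  using assms(1)
proof (induction ps)
  case (Cons p ps)
  have p: "p = [v, y] \<or> p = [y, v]" using Cons.prems by simp
  have IH: "distinct_adj (concat ps) \<longleftrightarrow> set ps \<subseteq> {[v, y]} \<or> set ps \<subseteq> {[y, v]}"
    using Cons.IH Cons.prems by simp
  show ?case
  proof (cases ps)
    case Nil
    then show ?thesis using p assms(2) by auto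
  next
    case ps: (Cons q qs)
    have q: "q = [v, y] \<or> q = [y, v]" using Cons.prems ps by simp
    then have "hd (concat ps) = hd q" "concat ps \<noteq> []" by (auto simp: ps)
    then have "distinct_adj (concat (p # ps)) \<longleftrightarrow> last p \<noteq> hd q \<and> distinct_adj (concat ps)"
      using p assms(2) by (auto simp: distinct_adj_append_iff)
    also have "last p \<noteq> hd q \<longleftrightarrow> p = q" using p q assms(2) by auto
    finally show ?thesis unfolding IH using ps p q assms(2) by auto
  qed
qed simp

section \<open>Expanding the letters of a word\<close>

text \<open>The words are attached to occurrences, not to letters, so that one letter can be
  replaced by different words at different places.\<close>

definition expand :: "('a \<times> 'b list) list \<Rightarrow> ('a \<times> 'b) list" where
  "expand Z = concat (map (\<lambda>(u, L). map (Pair u) L) Z)"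

lemma expand_simps [simp]:
  "expand [] = []" "expand ((u, L) # Z) = map (Pair u) L @ expand Z"
  "expand (Z @ Z') = expand Z @ expand Z'"
  by (simp_all add: expand_def)

lemma set_expand: "set (expand Z) = {(u, v). \<exists>L. (u, L) \<in> set Z \<and> v \<in> set L}"
  by (auto simp: expand_def)

lemma filter_eq_distinct: "distinct L \<Longrightarrow> v \<in> set L \<Longrightarrow> filter (\<lambda>z. z = v) L = [v]"
  by (induction L) (auto simp: filter_empty_conv)

text \<open>Each \<open>L\<close> contains \<open>v\<close> and \<open>y\<close> exactly once, so a
  block over \<open>u\<close> contributes one \<open>(u, v)\<close>, a block over \<open>x\<close>
  one \<open>(x, y)\<close>, and any other block nothing.\<close>

lemma map_fst_filter_expand:
  assumes "\<And>a L. (a, L) \<in> set Z \<Longrightarrow> distinct L \<and> set L = B" "v \<in> B" "y \<in> B" "u \<noteq> x"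
  shows "map fst (filter (\<lambda>z. z = (u, v) \<or> z = (x, y)) (expand Z)) =
    filter (\<lambda>a. a = u \<or> a = x) (map fst Z)"
  using assms(1)
proof (induction Z)
  case (Cons p Z)
  obtain a L where p: "p = (a, L)" by fastforce
  have "distinct L" "set L = B" using Cons.prems[of a L] p by auto
  then have "filter (\<lambda>b. b = v) L = [v]" "filter (\<lambda>b. b = y) L = [y]"
    using assms by (auto intro: filter_eq_distinct)
  then show ?case using Cons assms(4) by (auto simp: p filter_map o_def)
qed simp

lemma alternate_expand_neq:
  assumes "\<And>a L. (a, L) \<in> set Z \<Longrightarrow> distinct L \<and> set L = B" "v \<in> B" "y \<in> B" "u \<noteq> x"
  shows "alternate (u, v) (x, y) (expand Z) \<longleftrightarrow> alternate u x (map fst Z)"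
proof -
  \<comment> \<open>As \<open>u\<close> and \<open>x\<close> differ, \<open>fst\<close> separates
    the two letters, so projecting preserves and reflects alternation.\<close>
  have "inj_on fst (set (filter (\<lambda>z. z = (u, v) \<or> z = (x, y)) (expand Z)))"
    using assms(4) by (auto simp: inj_on_def)
  from distinct_adj_map_iff[OF this] show ?thesis
    unfolding alternate_def using map_fst_filter_expand[OF assms] by simp
qed

lemma map_snd_filter_expand:
  "map snd (filter (\<lambda>z. z = (u, v) \<or> z = (u, y)) (expand Z)) =
     concat (map (filter (\<lambda>b. b = v \<or> b = y)) (map snd (filter (\<lambda>p. fst p = u) Z)))"
  by (induction Z) (auto simp: filter_map o_def)

lemma alternate_expand_same:
  "alternate (u, v) (u, y) (expand Z) \<longleftrightarrow>
     distinct_adj (concat (map (filter (\<lambda>b. b = v \<or> b = y)) (map snd (filter (\<lambda>p. fst p = u) Z))))"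
proof -
  have "inj_on snd (set (filter (\<lambda>z. z = (u, v) \<or> z = (u, y)) (expand Z)))"
    by (auto simp: inj_on_def)
  from distinct_adj_map_iff[OF this] show ?thesis
    unfolding alternate_def map_snd_filter_expand by simp
qed

section \<open>Linear extensions\<close>

text \<open>These are the topological sorts of any relation \<open>R\<close>. Below they are also
  taken for an order enlarged by one pair, which may fail to be transitive.\<close>

definition linear_extensions :: "'a set \<Rightarrow> 'a rel \<Rightarrow> 'a list set" where
  "linear_extensions B R = {L. distinct L \<and> set L = B \<and> sorted_wrt (\<lambda>x y. (y, x) \<notin> R) L}"

lemma finite_linear_extensions: "finite B \<Longrightarrow> finite (linear_extensions B R)"
  by (rule finite_subset[OF _ finite_subset_distinct[of B]]) (auto simp: linear_extensions_def)

text \<open>Topological sorting: an \<open>R\<close>-minimal element of \<open>B\<close> goes first,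
  and the rest is listed by induction.\<close>

lemma linear_extensions_nonempty:
  assumes "finite B" "wf R"
  shows "linear_extensions B R \<noteq> {}"
  using assms(1)
proof (induction B rule: finite_psubset_induct)
  case (psubset B)
  show ?case
  proof (cases "B = {}")
    case True
    then show ?thesis by (auto simp: linear_extensions_def)
  next
    case False
    then obtain z where z: "z \<in> B" "\<And>y. (y, z) \<in> R \<Longrightarrow> y \<notin> B"
      using wfE_min[OF assms(2)] by (metis all_not_in_conv)
    with psubset.IH[of "B - {z}"] obtain L where "L \<in> linear_extensions (B - {z}) R" by blast
    with z have "z # L \<in> linear_extensions B R" by (auto simp: linear_extensions_def)
    then show ?thesis by blast
  qed
qed

lemma filter_two_distinct:
  assumes "distinct L" "v \<in> set L" "y \<in> set L" "v \<noteq> y"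
  shows "filter (\<lambda>b. b = v \<or> b = y) L = [v, y] \<or> filter (\<lambda>b. b = v \<or> b = y) L = [y, v]"
proof -
  let ?f = "filter (\<lambda>b. b = v \<or> b = y) L"
  have f: "distinct ?f" "set ?f = {v, y}" using assms by auto
  then have "length ?f = 2" using distinct_card[of ?f] assms(4) by simp
  then obtain a b where "?f = [a, b]"
    by (metis (no_types, lifting) One_nat_def Suc_1 length_0_conv length_Suc_conv)
  with f assms(4) show ?thesis by (auto simp: doubleton_eq_iff)
qed

lemma filter_linear_extension:
  assumes "L \<in> linear_extensions B R" "v \<in> B" "y \<in> B" "v \<noteq> y"
  shows "filter (\<lambda>b. b = v \<or> b = y) L \<in> {[v, y], [y, v]}"
    and "(v, y) \<in> R \<Longrightarrow> filter (\<lambda>b. b = v \<or> b = y) L = [v, y]"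
    and "(y, v) \<in> R \<Longrightarrow> filter (\<lambda>b. b = v \<or> b = y) L = [y, v]"
proof -
  let ?f = "filter (\<lambda>b. b = v \<or> b = y) L"
  have L: "distinct L" "set L = B" "sorted_wrt (\<lambda>x y. (y, x) \<notin> R) L"
    using assms(1) by (auto simp: linear_extensions_def)
  show *: "?f \<in> {[v, y], [y, v]}"
    using filter_two_distinct[of L v y] L assms(2-) by blast
  have "sorted_wrt (\<lambda>x y. (y, x) \<notin> R) ?f" using L(3) by (rule sorted_wrt_filter)
  then show "(v, y) \<in> R \<Longrightarrow> ?f = [v, y]" "(y, v) \<in> R \<Longrightarrow> ?f = [y, v]"
    using * by auto
qed

text \<open>As \<open>y\<close> is not below \<open>v\<close>, adding \<open>(v, y)\<close> to
  \<open>T\<close> creates no cycle, and every topological sort of the enlarged relation puts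
  \<open>v\<close> before \<open>y\<close>.\<close>

lemma linear_extension_incomparable:
  assumes "finite B" "T \<subseteq> B \<times> B" "asym T" "trans T"
    and "v \<in> B" "y \<in> B" "v \<noteq> y" "(y, v) \<notin> T"
  shows "\<exists>L \<in> linear_extensions B T. filter (\<lambda>b. b = v \<or> b = y) L = [v, y]"
proof -
  have fin: "finite T" using assms(1,2) by (meson finite_SigmaI finite_subset)
  have "acyclic T" using assms(3,4) by (auto simp: acyclic_def trancl_id asym_on_def)
  \<comment> \<open>A cycle through the new pair would need a path from \<open>y\<close> to
    \<open>v\<close>, which by transitivity would be the pair \<open>(y, v)\<close> itself.\<close>
  moreover have "(y, v) \<notin> T\<^sup>*" using assms(4,7,8) by (auto simp: rtrancl_eq_or_trancl trancl_id)
  ultimately have "wf (insert (v, y) T)" using fin by (intro finite_acyclic_wf) auto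
  then obtain L where L: "L \<in> linear_extensions B (insert (v, y) T)"
    using linear_extensions_nonempty[OF assms(1)] by blast
  \<comment> \<open>The larger relation only forbids more inversions.\<close>
  moreover have "L \<in> linear_extensions B T"
    using L by (auto simp: linear_extensions_def intro: sorted_wrt_mono_rel[rotated])
  ultimately show ?thesis using filter_linear_extension(2)[OF L assms(5-7)] by blast
qed

text \<open>Comparable elements keep their order in every linear extension; incomparable ones occur
  in both orders, since either pair can be added to \<open>T\<close>.\<close>

lemma comparable_iff_same_order:
  assumes "finite B" "T \<subseteq> B \<times> B" "asym T" "trans T" "v \<in> B" "y \<in> B" "v \<noteq> y"
  defines "S \<equiv> filter (\<lambda>b. b = v \<or> b = y) ` linear_extensions B T"
  shows "(v, y) \<in> T \<or> (y, v) \<in> T \<longleftrightarrow> S \<subseteq> {[v, y]} \<or> S \<subseteq> {[y, v]}"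
proof
  assume "(v, y) \<in> T \<or> (y, v) \<in> T"
  then show "S \<subseteq> {[v, y]} \<or> S \<subseteq> {[y, v]}"
    using filter_linear_extension(2,3)[OF _ assms(5-7)] unfolding S_def by blast
next
  assume *: "S \<subseteq> {[v, y]} \<or> S \<subseteq> {[y, v]}"
  show "(v, y) \<in> T \<or> (y, v) \<in> T"
  proof (rule ccontr)
    assume "\<not> ((v, y) \<in> T \<or> (y, v) \<in> T)"
    then have "[v, y] \<in> S" "[y, v] \<in> S"
      using linear_extension_incomparable[OF assms(1-4), of v y]
        linear_extension_incomparable[OF assms(1-4), of y v] assms(5-7)
      unfolding S_def by (force simp: disj_commute image_iff)+
    with * assms(7) show False by auto
  qed
qed

section \<open>Word-representable lexicographic products\<close>

text \<open>All letters of \<open>w\<close> get the first label. Each further label is carried by an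
  appended permutation of the letters, which leaves the represented graph unchanged.\<close>

lemma represents_with_labels:
  assumes "finite S" "S \<noteq> {}" "set w = pverts F" "represents w F"
  shows "\<exists>Z. represents (map fst Z) F \<and> set Z = pverts F \<times> S"
  using assms(1,2)
proof (induction S rule: finite_ne_induct)
  case (singleton L)
  have "map fst (map (\<lambda>u. (u, L)) w) = w" by (simp add: o_def)
  then show ?case using assms(3,4) by (intro exI[of _ "map (\<lambda>u. (u, L)) w"]) auto
next
  case (insert L S)
  then obtain Z where Z: "represents (map fst Z) F" "set Z = pverts F \<times> S" by blast
  let ?Z = "Z @ map (\<lambda>u. (u, L)) (remdups (map fst Z))"
  have "set (map fst Z) = pverts F" using Z(2) insert.hyps(2) by auto
  then have "represents (map fst Z @ remdups (map fst Z)) F"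
    using represents_append_remdups Z(1) by blast
  moreover have "map fst ?Z = map fst Z @ remdups (map fst Z)" by (simp add: o_def)
  moreover have "set ?Z = pverts F \<times> insert L S"
    using Z(2) insert.hyps(2) by (auto simp: image_iff)
  ultimately show ?case by metis
qed

lemma word_representable_lex_product_comparability:
  assumes F: "word_representable F" and C: "comparability_graph C"
  shows "word_representable (F \<circ>\<^sub>L C)"
proof -
  let ?B = "pverts C"
  obtain w where w: "set w = pverts F" "represents w F" and gF: "pair_graph F"
    using F by (auto simp: word_representable_def)
  obtain T where gC: "pair_graph C" and T: "parcs C = T \<union> T\<inverse>" "asym T" "trans T"
    using C by (auto simp: comparability_graph_def transitive_orientation_def)
  have B: "finite ?B" "T \<subseteq> ?B \<times> ?B" using gC T(1) by (auto simp: pair_graph_iff)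
  let ?S = "linear_extensions ?B T"
  have "wf T"
    using B T(2,3) by (intro finite_acyclic_wf)
      (auto simp: acyclic_def trancl_id asym_on_def intro: finite_subset)
  then have "?S \<noteq> {}" using B(1) linear_extensions_nonempty by blast
  then obtain Z where Z: "represents (map fst Z) F" "set Z = pverts F \<times> ?S"
    using represents_with_labels[OF finite_linear_extensions[OF B(1)] _ w] by blast
  have Zd: "distinct L \<and> set L = ?B" if "(a, L) \<in> set Z" for a L
    using that Z(2) by (auto simp: linear_extensions_def)
  have "set (expand Z) \<subseteq> pverts (F \<circ>\<^sub>L C)"
    using Z(2) Zd by (auto simp: set_expand lex_product_def)
  moreover have "((u, v), (x, y)) \<in> parcs (F \<circ>\<^sub>L C) \<longleftrightarrow> alternate (u, v) (x, y) (expand Z)"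
    if uvxy: "u \<in> pverts F" "v \<in> ?B" "x \<in> pverts F" "y \<in> ?B" and ne: "(u, v) \<noteq> (x, y)" for u v x y
  proof (cases "u = x")
    case False
    then show ?thesis
      using in_parcs_lex_product[of u F x v C y] uvxy Z(1)
        alternate_expand_neq[of Z ?B v y u x] Zd
      by (auto simp: represents_def)
  next
    case True
    then have "v \<noteq> y" using ne by simp
    let ?ps = "map (filter (\<lambda>b. b = v \<or> b = y)) (map snd (filter (\<lambda>p. fst p = u) Z))"
    \<comment> \<open>Every pair \<open>(u, L)\<close> occurs in \<open>Z\<close>, so the blocks
      over \<open>u\<close> run through all linear extensions.\<close>
    have ps: "set ?ps = filter (\<lambda>b. b = v \<or> b = y) ` ?S"
      using Z(2) uvxy(1) by (force simp: image_iff)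
    have "alternate (u, v) (x, y) (expand Z) \<longleftrightarrow> distinct_adj (concat ?ps)"
      unfolding True[symmetric] by (rule alternate_expand_same)
    also have "\<dots> \<longleftrightarrow> set ?ps \<subseteq> {[v, y]} \<or> set ?ps \<subseteq> {[y, v]}"
    proof (intro distinct_adj_concat_pairs \<open>v \<noteq> y\<close>)
      show "p = [v, y] \<or> p = [y, v]" if "p \<in> set ?ps" for p
        using that filter_linear_extension(1)[OF _ uvxy(2,4) \<open>v \<noteq> y\<close>] unfolding ps by blast
    qed
    also have "\<dots> \<longleftrightarrow> (v, y) \<in> T \<or> (y, v) \<in> T"
      using comparable_iff_same_order[OF B T(2,3) uvxy(2,4) \<open>v \<noteq> y\<close>] ps by simp
    \<comment> \<open>\<open>F\<close> has no loops, so vertices over the same \<open>u\<close> are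
      joined only by arcs of \<open>C\<close>.\<close>
    also have "\<dots> \<longleftrightarrow> ((u, v), (x, y)) \<in> parcs (F \<circ>\<^sub>L C)"
      using in_parcs_lex_product[of u F x v C y] uvxy True gF T(1)
      by (auto simp: pair_graph_iff irrefl_def)
    finally show ?thesis by simp
  qed
  then have "represents (expand Z) (F \<circ>\<^sub>L C)"
    unfolding represents_def by (auto simp: lex_product_def)
  ultimately show ?thesis
    using pair_graph_lex_product[OF gF gC] unfolding word_representable_iff_subset by blast
qed

text \<open>
  The copies of a representing word are written one after the other. As every letter occurs at least
  twice in its copy, letters of different copies do not alternate.
\<close>

lemma word_representable_edgeless_lex_product:
  assumes "finite A" and F: "word_representable F"
  shows "word_representable (edgeless A \<circ>\<^sub>L F)"
proof -
  let ?H = "edgeless A \<circ>\<^sub>L F"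
  obtain w0 where w0: "set w0 = pverts F" "represents w0 F" and gF: "pair_graph F"
    using F by (auto simp: word_representable_def)
  let ?w = "w0 @ remdups w0"
  obtain as where as: "set as = A" "distinct as" using assms(1) finite_distinct_list by blast
  let ?Z = "map (\<lambda>a. (a, ?w)) as"
  have w: "represents ?w F" using w0 by (rule represents_append_remdups)
  have "((u, v), (x, y)) \<in> parcs ?H \<longleftrightarrow> alternate (u, v) (x, y) (expand ?Z)"
    if uvxy: "u \<in> A" "v \<in> pverts F" "x \<in> A" "y \<in> pverts F" and ne: "(u, v) \<noteq> (x, y)" for u v x y
  proof (cases "u = x")
    case True
    \<comment> \<open>\<open>as\<close> has no repetitions, so exactly one copy of \<open>?w\<close>
      lies over \<open>u\<close>.\<close>
    have "filter (\<lambda>a. a = u) as = [u]" using as uvxy(1) by (intro filter_eq_distinct) auto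
    then have "alternate (u, v) (x, y) (expand ?Z) \<longleftrightarrow> alternate v y ?w"
      using True
      by (simp add: alternate_expand_same alternate_def[of v y] filter_map o_def del: filter_append)
    then show ?thesis
      using w in_parcs_lex_product[of u "edgeless A" x v F y] uvxy ne True by (simp add: represents_def)
  next
    case False
    obtain p q where pq: "as = p @ u # q" using as(1) uvxy(1) by (metis split_list)
    let ?f = "filter (\<lambda>z. z = (u, v) \<or> z = (x, y))"
    \<comment> \<open>As \<open>x\<close> differs from \<open>u\<close>, only \<open>(u, v)\<close>
      survives in the copy over \<open>u\<close>, at least twice in a row.\<close>
    have "?f (map (Pair u) ?w) = map (Pair u) (filter (\<lambda>z. z = v) ?w)"
      using False by (simp add: filter_map o_def del: filter_append map_append)
    then have mid: "\<not> distinct_adj (?f (map (Pair u) ?w))"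
      using not_distinct_adj_repeated[of v w0] uvxy(2) w0(1) distinct_adj_mapD by metis
    have split: "?f (expand ?Z) = ?f (expand (map (\<lambda>a. (a, ?w)) p)) @
        ?f (map (Pair u) ?w) @ ?f (expand (map (\<lambda>a. (a, ?w)) q))"
      by (simp add: pq)
    have "\<not> alternate (u, v) (x, y) (expand ?Z)"
      unfolding alternate_def split using mid by blast
    then show ?thesis
      using in_parcs_lex_product[of u "edgeless A" x v F y] uvxy False by simp
  qed
  then have "represents (expand ?Z) ?H"
    unfolding represents_def by (auto simp: lex_product_def)
  moreover have "set (expand ?Z) = set as \<times> set w0" unfolding set_expand by auto
  then have "set (expand ?Z) \<subseteq> pverts ?H" using as(1) w0(1) by (simp add: lex_product_def)
  moreover have "pair_graph ?H"
    using comparability_graph_edgeless[OF assms(1)] pair_graph_lex_product[OF _ gF]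
    unfolding comparability_graph_def by blast
  ultimately show ?thesis unfolding word_representable_iff_subset by blast
qed

section \<open>Adding and deleting vertices\<close>

lemma word_representable_add_vertex:
  assumes "word_representable F"
  shows "word_representable \<lparr>pverts = insert a (pverts F), parcs = parcs F\<rparr>"
proof (cases "a \<in> pverts F")
  case True
  then have "\<lparr>pverts = insert a (pverts F), parcs = parcs F\<rparr> = F"
    by (intro pair_pre_digraph.equality) auto
  then show ?thesis using assms by simp
next
  case False
  obtain w where w: "set w = pverts F" "represents w F" and gF: "pair_graph F"
    using assms by (auto simp: word_representable_def)
  let ?F = "\<lparr>pverts = insert a (pverts F), parcs = parcs F\<rparr>"
  \<comment> \<open>The two leading \<open>a\<close> stay adjacent when other letters are deleted,
    so \<open>a\<close> alternates with no letter and is isolated.\<close>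
  have "represents (a # a # w) ?F"
    using w(2) False gF by (auto simp: represents_def alternate_def pair_graph_iff)
  moreover have "pair_graph ?F" using gF by (auto simp: pair_graph_iff)
  ultimately show ?thesis using w(1) unfolding word_representable_def
    by (intro conjI exI[of _ "a # a # w"]) auto
qed

lemma word_representable_add_vertices:
  assumes "word_representable F" "pverts F \<subseteq> A" "finite A"
  shows "word_representable \<lparr>pverts = A, parcs = parcs F\<rparr>"
proof -
  have "word_representable \<lparr>pverts = D \<union> pverts F, parcs = parcs F\<rparr>" if "finite D" for D
    using that
  proof induction
    case empty
    have eq: "\<lparr>pverts = {} \<union> pverts F, parcs = parcs F\<rparr> = F"
      by (intro pair_pre_digraph.equality) auto
    show ?case unfolding eq by (rule assms(1))
  next
    case (insert a D)
    then show ?case using word_representable_add_vertex[OF insert.IH, of a] by simp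
  qed
  from this[OF assms(3)] show ?thesis using assms(2) by (simp add: Un_absorb2)
qed

text \<open>An induced subgraph, moved to first coordinates. It is defined for every graph on pairs,
  so the parts of a product can be sliced too.\<close>

definition slice :: "'b \<Rightarrow> ('a \<times> 'b) pair_pre_digraph \<Rightarrow> 'a pair_pre_digraph" where
  "slice b K = \<lparr>pverts = {u. (u, b) \<in> pverts K}, parcs = {(u, x). ((u, b), (x, b)) \<in> parcs K}\<rparr>"

text \<open>Deleting the letters outside the layer \<open>b\<close> does not affect how the
  remaining ones alternate.\<close>

lemma word_representable_slice:
  assumes "word_representable K"
  shows "word_representable (slice b K)"
proof -
  obtain w where w: "set w = pverts K" "represents w K" and gK: "pair_graph K"
    using assms by (auto simp: word_representable_def)
  let ?w = "map fst (filter (\<lambda>z. snd z = b) w)"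
  have alt: "alternate u x ?w \<longleftrightarrow> alternate (u, b) (x, b) w" for u x
  proof -
    have eq: "filter (\<lambda>z. z = u \<or> z = x) ?w = map fst (filter (\<lambda>z. z = (u, b) \<or> z = (x, b)) w)"
      by (induction w) auto
    have "inj_on fst (set (filter (\<lambda>z. z = (u, b) \<or> z = (x, b)) w))"
      by (auto simp: inj_on_def)
    from distinct_adj_map_iff[OF this] show ?thesis unfolding alternate_def eq .
  qed
  have "finite {u. (u, b) \<in> pverts K}"
  proof (rule finite_subset)
    show "{u. (u, b) \<in> pverts K} \<subseteq> fst ` pverts K" by force
    show "finite (fst ` pverts K)" using gK by (simp add: pair_graph_iff)
  qed
  then have "pair_graph (slice b K)"
    using gK by (auto simp: pair_graph_iff slice_def sym_def irrefl_def)
  moreover have "set ?w = pverts (slice b K)" using w(1) by (force simp: slice_def)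
  moreover have "represents ?w (slice b K)"
    using w(2) unfolding represents_def alt by (auto simp: slice_def)
  ultimately show ?thesis unfolding word_representable_def by blast
qed

text \<open>A further arc inside the layer would come from a loop \<open>(b, b)\<close>, which
  \<open>G\<close> does not have.\<close>

lemma slice_lex_product:
  assumes "pair_graph F" "pair_graph G" "b \<in> pverts G"
  shows "slice b (F \<circ>\<^sub>L G) = F"
  using assms by (auto simp: slice_def lex_product_def pair_graph_iff irrefl_def
      intro!: pair_pre_digraph.equality)

section \<open>The multi-word-representation number\<close>

text \<open>For \<open>a = b\<close> this is a single vertex, so edges and isolated vertices are
  treated alike.\<close>

lemma word_representable_edge:
  "word_representable \<lparr>pverts = {a, b}, parcs = {(a, b), (b, a)} - Id\<rparr>"
  unfolding word_representable_def represents_def alternate_def pair_graph_iff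
  by (auto simp: sym_def irrefl_def intro!: exI[of _ "[a, b]"])

text \<open>Ensures that the \<open>LEAST\<close> in \<open>\<mu>\<close> is attained. The parts are
  the single edges and the single vertices.\<close>

lemma union_of_word_representable_exists:
  assumes "pair_graph G"
  shows "\<exists>k>0. union_of word_representable k G"
proof -
  let ?g = "\<lambda>(a, b). \<lparr>pverts = {a, b}, parcs = {(a, b), (b, a)} - Id\<rparr>"
  have G: "finite (pverts G)" "parcs G \<subseteq> pverts G \<times> pverts G" "sym (parcs G)" "irrefl (parcs G)"
    using assms by (auto simp: pair_graph_iff)
  have "finite (parcs G \<union> Id_on (pverts G))"
  proof (rule finite_subset)
    show "parcs G \<union> Id_on (pverts G) \<subseteq> pverts G \<times> pverts G" using G(2) by blast
  qed (use G(1) in simp)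
  from finite_list[OF this] obtain es where es: "set es = parcs G \<union> Id_on (pverts G)" ..
  \<comment> \<open>The empty graph provides a part even if \<open>G\<close> has no
    vertices.\<close>
  let ?gs = "edgeless {} # map ?g es"
  have "word_representable (edgeless {})"
    by (auto simp: word_representable_def represents_def pair_graph_iff sym_def irrefl_def)
  then have wr: "word_representable F" if "F \<in> set ?gs" for F
    using that word_representable_edge by auto
  have UN: "(\<Union>i<length ?gs. f (?gs ! i)) = (\<Union>F\<in>set ?gs. f F)" for f :: "_ \<Rightarrow> 'c set"
    by (auto simp only: set_conv_nth)
  have "(\<Union>F\<in>set ?gs. pverts F) = (\<Union>(a, b)\<in>set es. {a, b})" by auto
  also have "\<dots> = pverts G" unfolding es using G(2) by (auto simp: Id_on_def)
  finally have "pverts G = (\<Union>F\<in>set ?gs. pverts F)" ..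
  moreover have "(\<Union>F\<in>set ?gs. parcs F) = (\<Union>(a, b)\<in>set es. {(a, b), (b, a)} - Id)" by auto
  then have "(\<Union>F\<in>set ?gs. parcs F) = parcs G"
    unfolding es using G(3,4) by (auto simp: Id_on_def sym_def irrefl_def)
  then have "parcs G = (\<Union>F\<in>set ?gs. parcs F)" ..
  ultimately have "G = graph_union (length ?gs) ((!) ?gs)"
    unfolding graph_union_def UN by (intro pair_pre_digraph.equality) auto
  moreover have "\<forall>i<length ?gs. word_representable (?gs ! i)" using wr nth_mem by blast
  ultimately show ?thesis unfolding union_of_def by (intro exI[of _ "length ?gs"]) auto
qed

lemma multi_word_number_union_of:
  assumes "pair_graph G"
  shows "0 < \<mu> G" "union_of word_representable (\<mu> G) G"
  using LeastI_ex[OF union_of_word_representable_exists[OF assms]]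
  by (simp_all add: multi_word_number_def)

lemma multi_word_number_le:
  "0 < k \<Longrightarrow> union_of word_representable k G \<Longrightarrow> \<mu> G \<le> k"
  by (simp add: multi_word_number_def Least_le)

section \<open>Lexicographic products of unions\<close>

lemma graph_union_lex_product_edgeless:
  assumes "0 < k" "\<And>i. i < k \<Longrightarrow> pair_graph (F i)" "\<And>i. i < l \<Longrightarrow> pair_graph (F' i)"
  shows "graph_union k F \<circ>\<^sub>L graph_union l F' =
    graph_union (k + l) (\<lambda>i. if i < k then F i \<circ>\<^sub>L edgeless (pverts (graph_union l F'))
      else edgeless (pverts (graph_union k F)) \<circ>\<^sub>L F' (i - k))" (is "?L = graph_union _ ?K")
proof (intro pair_pre_digraph.equality)
  \<comment> \<open>Arcs of a product must have their endpoints in both vertex sets;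
    \<open>wf\<close> and \<open>wf'\<close> supply this for arcs of the parts.\<close>
  have wf: "u \<in> pverts (F i) \<and> x \<in> pverts (F i)" if "(u, x) \<in> parcs (F i)" "i < k" for u x i
    using assms(2)[OF that(2)] that(1) by (auto simp: pair_graph_iff)
  have wf': "u \<in> pverts (F' i) \<and> x \<in> pverts (F' i)" if "(u, x) \<in> parcs (F' i)" "i < l" for u x i
    using assms(3)[OF that(2)] that(1) by (auto simp: pair_graph_iff)
  have split: "(\<Union>i<k + l. f (?K i)) = (\<Union>i<k. f (F i \<circ>\<^sub>L edgeless (pverts (graph_union l F')))) \<union>
      (\<Union>j<l. f (edgeless (pverts (graph_union k F)) \<circ>\<^sub>L F' j))" for f :: "_ \<Rightarrow> 'c set"
  proof -
    \<comment> \<open>The indices from \<open>k\<close> on are shifts by \<open>k\<close>, so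
      \<open>i - k\<close> runs through the indices of \<open>F'\<close>.\<close>
    have "{..<k + l} = {..<k} \<union> (+) k ` {..<l}"
      using atLeast0LessThan image_add_atLeastLessThan[of k 0 l] by auto
    then show ?thesis by (simp add: image_Un)
  qed
  show "pverts ?L = pverts (graph_union (k + l) ?K)"
    using assms split[of pverts] by (auto simp: lex_product_def graph_union_def)
  show "parcs ?L = parcs (graph_union (k + l) ?K)"
    unfolding graph_union_def pair_pre_digraph.simps split[unfolded graph_union_def pair_pre_digraph.simps]
    unfolding lex_product_def pair_pre_digraph.simps
    by (auto dest: wf wf') (use wf wf' in \<open>meson lessThan_iff\<close>)+
qed simp

text \<open>Without padding, an arc \<open>(u, x)\<close> of \<open>F i\<close> would give no arc
  from \<open>(u, v)\<close> to \<open>(x, y)\<close> in part \<open>i\<close> when \<open>v\<close>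
  or \<open>y\<close> is not a vertex of \<open>F' i\<close>.\<close>

lemma graph_union_lex_product_padded:
  assumes "0 < k" "\<And>i. i < k \<Longrightarrow> pair_graph (F i)" "\<And>i. i < k \<Longrightarrow> pair_graph (F' i)"
  shows "graph_union k F \<circ>\<^sub>L graph_union k F' =
    graph_union k (\<lambda>i. \<lparr>pverts = pverts (graph_union k F), parcs = parcs (F i)\<rparr> \<circ>\<^sub>L
      \<lparr>pverts = pverts (graph_union k F'), parcs = parcs (F' i)\<rparr>)" (is "?L = graph_union _ ?K")
proof (intro pair_pre_digraph.equality)
  have "parcs (F i) \<subseteq> pverts (graph_union k F) \<times> pverts (graph_union k F)"
    "parcs (F' i) \<subseteq> pverts (graph_union k F') \<times> pverts (graph_union k F')" if "i < k" for i
    using that assms(2,3)[OF that] by (auto simp: pair_graph_iff graph_union_def)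
  then show "parcs ?L = parcs (graph_union k ?K)" 
    by (fastforce simp: lex_product_def graph_union_def)
  show "pverts ?L = pverts (graph_union k ?K)"
    using assms(1) by (auto simp: lex_product_def graph_union_def)
qed simp

section \<open>Bounds for the lexicographic product\<close>

lemma multi_word_number_lex_product_le:
  assumes "pair_graph G1" "pair_graph G2"
  shows "\<mu> (G1 \<circ>\<^sub>L G2) \<le> \<mu> G1 + \<mu> G2"
proof -
  obtain F where F: "\<forall>i<\<mu> G1. word_representable (F i)" "G1 = graph_union (\<mu> G1) F"
    using multi_word_number_union_of(2)[OF assms(1)] unfolding union_of_def by blast
  obtain F' where F': "\<forall>i<\<mu> G2. word_representable (F' i)" "G2 = graph_union (\<mu> G2) F'"
    using multi_word_number_union_of(2)[OF assms(2)] unfolding union_of_def by blast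
  let ?K = "\<lambda>i. if i < \<mu> G1 then F i \<circ>\<^sub>L edgeless (pverts G2)
    else edgeless (pverts G1) \<circ>\<^sub>L F' (i - \<mu> G1)"
  have fin: "finite (pverts G1)" "finite (pverts G2)" using assms by (auto simp: pair_graph_iff)
  have "word_representable (?K i)" if "i < \<mu> G1 + \<mu> G2" for i
    using that F(1) F'(1) fin
    by (auto intro!: word_representable_lex_product_comparability comparability_graph_edgeless
        word_representable_edgeless_lex_product)
  moreover have "G1 \<circ>\<^sub>L G2 = graph_union (\<mu> G1 + \<mu> G2) ?K"
    using graph_union_lex_product_edgeless[of "\<mu> G1" F "\<mu> G2" F', folded F(2) F'(2)]
      multi_word_number_union_of(1)[OF assms(1)] F(1) F'(1) by (simp add: word_representable_def)
  ultimately have "union_of word_representable (\<mu> G1 + \<mu> G2) (G1 \<circ>\<^sub>L G2)"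
    unfolding union_of_def by (intro exI[of _ ?K]) simp
  then show ?thesis
    using multi_word_number_union_of(1)[OF assms(1)] by (intro multi_word_number_le) auto
qed

text \<open>Both classes of parts are closed under adding isolated vertices, so the padded factors
  still have a word-representable product.\<close>

lemma multi_word_number_lex_product_comparability_le:
  assumes "pair_graph G1" "pair_graph G2" "union_of comparability_graph (\<mu> G1) G2"
  shows "\<mu> (G1 \<circ>\<^sub>L G2) \<le> \<mu> G1"
proof -
  obtain F where F: "\<forall>i<\<mu> G1. word_representable (F i)" "G1 = graph_union (\<mu> G1) F"
    using multi_word_number_union_of(2)[OF assms(1)] unfolding union_of_def by blast
  obtain C where C: "\<forall>i<\<mu> G1. comparability_graph (C i)" "G2 = graph_union (\<mu> G1) C"
    using assms(3) unfolding union_of_def by blast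
  let ?K = "\<lambda>i. \<lparr>pverts = pverts G1, parcs = parcs (F i)\<rparr> \<circ>\<^sub>L
      \<lparr>pverts = pverts G2, parcs = parcs (C i)\<rparr>"
  have fin: "finite (pverts G1)" "finite (pverts G2)" using assms by (auto simp: pair_graph_iff)
  have sub: "pverts (F i) \<subseteq> pverts G1" "pverts (C i) \<subseteq> pverts G2" if "i < \<mu> G1" for i
    using that arg_cong[OF F(2), of pverts] arg_cong[OF C(2), of pverts]
    by (auto simp: graph_union_def)
  have "word_representable (?K i)" if "i < \<mu> G1" for i
    using that F(1) C(1) fin sub
    by (intro word_representable_lex_product_comparability word_representable_add_vertices
        comparability_graph_add_vertices) auto
  moreover have "G1 \<circ>\<^sub>L G2 = graph_union (\<mu> G1) ?K"
    using graph_union_lex_product_padded[of "\<mu> G1" F C, folded F(2) C(2)]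
      multi_word_number_union_of(1)[OF assms(1)] F(1) C(1) by (simp add: word_representable_def comparability_graph_def)
  ultimately have "union_of word_representable (\<mu> G1) (G1 \<circ>\<^sub>L G2)"
    unfolding union_of_def by (intro exI[of _ ?K]) simp
  then show ?thesis
    using multi_word_number_union_of(1)[OF assms(1)] by (intro multi_word_number_le)
qed

text \<open>Slicing commutes with unions, so slicing the parts of the product at a vertex
  \<open>b\<close> of \<open>G2\<close> gives equally many parts with union
  \<open>G1\<close>.\<close>

lemma multi_word_number_le_lex_product:
  assumes "pair_graph G1" "pair_graph G2" "pverts G2 \<noteq> {}"
  shows "\<mu> G1 \<le> \<mu> (G1 \<circ>\<^sub>L G2)"
proof -
  let ?H = "G1 \<circ>\<^sub>L G2"
  have H: "pair_graph ?H" using assms(1,2) by (rule pair_graph_lex_product)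
  obtain b where b: "b \<in> pverts G2" using assms(3) by blast
  obtain K where K: "\<forall>i<\<mu> ?H. word_representable (K i)" "?H = graph_union (\<mu> ?H) K"
    using multi_word_number_union_of(2)[OF H] unfolding union_of_def by blast
  have "G1 = slice b ?H" using slice_lex_product[OF assms(1,2) b] by simp
  also have "\<dots> = slice b (graph_union (\<mu> ?H) K)" using K(2) by simp
  also have "\<dots> = graph_union (\<mu> ?H) (\<lambda>i. slice b (K i))"
    by (auto simp: slice_def graph_union_def)
  finally have "union_of word_representable (\<mu> ?H) G1"
    using K(1) unfolding union_of_def
    by (intro exI[of _ "\<lambda>i. slice b (K i)"] conjI) (auto intro: word_representable_slice)
  then show ?thesis using multi_word_number_union_of(1)[OF H] by (intro multi_word_number_le)
qed

text \<open>If \<open>G2\<close> has no vertices, the product is empty and has number 1, while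
  \<open>\<mu> G1\<close> can be larger; hence the condition \<open>pverts G2 \<noteq> {}\<close> on
  the equality.\<close>

theorem theorem11:
  fixes G1 :: "'a pair_pre_digraph" and G2 :: "'b pair_pre_digraph"
    and H :: "('a \<times> 'b) pair_pre_digraph" and k1 k2 :: nat
  assumes "pair_graph G1" and "pair_graph G2"
    and "\<mu> G1 = k1" and "\<mu> G2 = k2"
    and "H = G1 \<circ>\<^sub>L G2"
  shows "\<mu> H \<le> k1 + k2 \<and>
    (pverts G2 \<noteq> {} \<and> k1 \<ge> k2 \<and> union_of comparability_graph k1 G2 \<longrightarrow> \<mu> H = k1)"
  using multi_word_number_lex_product_le[OF assms(1,2)]
    multi_word_number_lex_product_comparability_le[OF assms(1,2)]
    multi_word_number_le_lex_product[OF assms(1,2)] assms(3-5)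
  by (blast intro: antisym)

end
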